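(* Let $p$ be an odd prime, $n$ a positive integer and $r$ an integer. (a) $S_1(n,r)\equiv S_2(n,r) \pmod p$. (b) If $n=(p-1)s$ for an integer $s$, then $S_1(n,r)\equiv(-1)^{s-1}\pmod p$; if $n=(p-1)s-1$ for an integer $s$, then $S_1(n,r)\equiv(-1)^{s-1}\left(\frac{s+1}{2}+r\right)\pmod p$. (c) $S_1(n+p(p-1),r)\equiv -S_1(n,r)\pmod p$.
   Context: For a prime $p$, a positive integer $n$ and any integer $r$, define $$S_1(n,r)=p^{-\left[\frac{n-1}{p-1}\right]}\sum_{k\equiv r\ (\mathrm{mod}\ p)}(-1)^k\binom{n}{k},\qquad S_2(n,r)=p^{-\left[\frac{n-1}{p-1}\right]}\sum_{k\equiv pr\ (\mathrm{mod}\ p^2)}(-1)^k\binom{pn}{k},$$ where $[x]$ is the integer part. These are known to be integers. The fraction $\frac{s+1}{2}$ is interpreted modulo the odd prime $p$. *)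

theory Defs
  imports "HOL-Number_Theory.Number_Theory"
begin

(* Both sums are finite since n choose k = 0 for k > n, so restricting to k \<le> n loses nothing.
   Integer division rounds down, so the exponent is the integer part of (n - 1) / (p - 1).
   The values are taken in the rationals, so that dividing by the power of p is exact. *)

definition S1 :: "nat \<Rightarrow> nat \<Rightarrow> int \<Rightarrow> rat" where
  "S1 p n r = of_nat p powi (- ((int n - 1) div (int p - 1))) *
     (\<Sum>k | k \<le> n \<and> [int k = r] (mod int p). (-1) ^ k * of_nat (n choose k))"

definition S2 :: "nat \<Rightarrow> nat \<Rightarrow> int \<Rightarrow> rat" where
  "S2 p n r = of_nat p powi (- ((int n - 1) div (int p - 1))) *
     (\<Sum>k | k \<le> p * n \<and> [int k = int p * r] (mod (int p)\<^sup>2). (-1) ^ k * of_nat ((p * n) choose k))"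

definition p_integral :: "nat \<Rightarrow> rat \<Rightarrow> bool" where
  "p_integral p x \<longleftrightarrow> (\<exists>u v::int. coprime v (int p) \<and> v \<noteq> 0 \<and> x = of_int u / of_int v)"

(* Congruence modulo p in the ring of fractions with denominator prime to p. The library's
   cong is useless here: rat is a field, so cong at type rat is trivially true for p \<noteq> 0.
   On integers this is ordinary congruence (lemma rat_cong_of_int). The two p_integral
   conjuncts make a congruence that involves S1 or S2 also assert that these are
   integers (lemmas S1_integral_iff and S2_integral_iff). *)

definition rat_cong :: "nat \<Rightarrow> rat \<Rightarrow> rat \<Rightarrow> bool" where
  "rat_cong p x y \<longleftrightarrow> p_integral p x \<and> p_integral p y \<and>
     (\<exists>z. p_integral p z \<and> x - y = of_nat p * z)"

lemma p_integral_of_int: "p_integral p (of_int x)"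
  unfolding p_integral_def by (rule exI[of _ x], rule exI[of _ 1]) simp

lemma rat_cong_of_int:
  "rat_cong p (of_int x) (of_int y) \<longleftrightarrow> [x = y] (mod int p)"
proof
  assume "rat_cong p (of_int x) (of_int y)"
  then obtain u v :: int where uv: "coprime v (int p)" "v \<noteq> 0"
    and eq: "of_int x - of_int y = of_nat p * (of_int u / of_int v :: rat)"
    unfolding rat_cong_def p_integral_def by blast
  have "(of_int ((x - y) * v) :: rat) = of_int (int p * u)"
    using eq uv(2) by (simp add: field_simps)
  then have "(x - y) * v = int p * u" by (simp only: of_int_eq_iff)
  then have "int p dvd (x - y) * v" by simp
  then have "int p dvd x - y"
    using uv(1) by (simp add: coprime_dvd_mult_left_iff coprime_commute)
  then show "[x = y] (mod int p)" by (simp add: cong_iff_dvd_diff)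
next
  assume "[x = y] (mod int p)"
  then obtain k where "x - y = int p * k" by (auto simp: cong_iff_dvd_diff)
  then have "(of_int x - of_int y :: rat) = of_nat p * of_int k"
    by (metis of_int_diff of_int_mult of_int_of_nat_eq)
  then show "rat_cong p (of_int x) (of_int y)"
    unfolding rat_cong_def using p_integral_of_int by blast
qed

lemma p_integral_divide_power_iff:
  assumes "p > 0"
  shows "p_integral p (of_nat p powi (- int e) * of_int a) \<longleftrightarrow> of_nat p powi (- int e) * of_int a \<in> (\<int> :: rat set)"
    (is "p_integral p ?x \<longleftrightarrow> _")
proof
  assume "p_integral p ?x"
  then obtain u v :: int where uv: "coprime v (int p)" "v \<noteq> 0" and eq: "?x = of_int u / of_int v"
    unfolding p_integral_def by blast
  have "(of_int (a * v) :: rat) = of_int (u * int p ^ e)"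
    using eq uv(2) assms by (simp add: power_int_minus field_simps)
  then have *: "a * v = u * int p ^ e" by (simp only: of_int_eq_iff)
  then have "v dvd u * int p ^ e" by (metis dvd_triv_right)
  then have "v dvd u" using uv(1) by (simp add: coprime_dvd_mult_left_iff)
  then obtain w where "u = v * w" by blast
  then show "?x \<in> \<int>" using eq uv(2) by simp
next
  assume "?x \<in> \<int>"
  then show "p_integral p ?x" by (metis Ints_cases p_integral_of_int)
qed

lemma S1_integral_iff:
  assumes "p > 1" "n > 0"
  shows "p_integral p (S1 p n r) \<longleftrightarrow> S1 p n r \<in> \<int>"
proof -
  define e where "e = nat ((int n - 1) div (int p - 1))"
  have e: "(int n - 1) div (int p - 1) = int e"
    using assms by (simp add: e_def pos_imp_zdiv_nonneg_iff)
  show ?thesis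
    using p_integral_divide_power_iff[of p e
      "\<Sum>k | k \<le> n \<and> [int k = r] (mod int p). (-1) ^ k * int (n choose k)"] assms(1)
    unfolding S1_def e by simp
qed

lemma S2_integral_iff:
  assumes "p > 1" "n > 0"
  shows "p_integral p (S2 p n r) \<longleftrightarrow> S2 p n r \<in> \<int>"
proof -
  define e where "e = nat ((int n - 1) div (int p - 1))"
  have e: "(int n - 1) div (int p - 1) = int e"
    using assms by (simp add: e_def pos_imp_zdiv_nonneg_iff)
  show ?thesis
    using p_integral_divide_power_iff[of p e
      "\<Sum>k | k \<le> p * n \<and> [int k = int p * r] (mod (int p)\<^sup>2). (-1) ^ k * int ((p * n) choose k)"] assms(1)
    unfolding S2_def e by simp
qed

end

theory Submission
  imports Defs "HOL-Computational_Algebra.Polynomial"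
begin

text \<open>The sums defining \<open>S\<^sub>1(n, \<cdot>)\<close> are the coefficients of \<open>Y\<^sup>n\<close>, \<open>Y = 1 - X\<close>, in
  \<open>\<int>[X]/(X\<^sup>p - 1)\<close>. There \<open>Y\<^sup>p\<^sup>-\<^sup>1 = N + p W\<close> with \<open>N = 1 + X + \<dots> + X\<^sup>p\<^sup>-\<^sup>1\<close> and
  \<open>Y N = 0\<close>, so for \<open>n = q (p - 1) + m\<close> with \<open>1 \<le> m \<le> p - 1\<close> dividing \<open>Y\<^sup>n\<close> by \<open>p\<^sup>q\<close>
  leaves \<open>W\<^sup>q Y\<^sup>m\<close>. Modulo \<open>p\<close> the ring becomes \<open>(\<int>/p)[Y]/(Y\<^sup>p)\<close>, and there
  \<open>W = -1 - Y/2 + O(Y\<^sup>2)\<close>. Part (b) follows by expanding \<open>W\<^sup>q\<close> to first order, and part (c)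
  from \<open>W\<^sup>p = -1\<close>. For part (a), write \<open>(1 - X)\<^sup>p = (1 - X\<^sup>p) + p g\<close>, where \<open>g\<close> has no
  coefficients at multiples of \<open>p\<close>, and expand the \<open>n\<close>-th power binomially: at multiples
  of \<open>p\<close>, only the term \<open>(1 - X\<^sup>p)\<^sup>n\<close> survives modulo \<open>p\<^sup>q\<^sup>+\<^sup>1\<close>.\<close>

section \<open>Linear functionals on integer polynomials, given by their values on monomials\<close>

definition coeff_sum :: "(nat \<Rightarrow> int) \<Rightarrow> int poly \<Rightarrow> int" where
  "coeff_sum \<phi> f = (\<Sum>k\<le>degree f. coeff f k * \<phi> k)"

lemma coeff_sum_eq:
  assumes "degree f \<le> N"
  shows "coeff_sum \<phi> f = (\<Sum>k\<le>N. coeff f k * \<phi> k)"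
  unfolding coeff_sum_def
  by (rule sum.mono_neutral_left) (use assms in \<open>auto simp: coeff_eq_0\<close>)

lemma coeff_sum_0 [simp]: "coeff_sum \<phi> 0 = 0"
  by (simp add: coeff_sum_def)

lemma coeff_sum_add [simp]: "coeff_sum \<phi> (f + g) = coeff_sum \<phi> f + coeff_sum \<phi> g"
proof -
  define N where "N = max (degree f) (degree g)"
  have "degree f \<le> N" "degree g \<le> N" "degree (f + g) \<le> N"
    unfolding N_def by (auto intro: degree_add_le)
  then show ?thesis
    by (simp add: coeff_sum_eq sum.distrib algebra_simps)
qed

lemma coeff_sum_smult [simp]: "coeff_sum \<phi> (smult c f) = c * coeff_sum \<phi> f"
  using coeff_sum_eq[of "smult c f" "degree f" \<phi>]
  by (simp add: degree_smult_le coeff_sum_def sum_distrib_left mult_ac)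

lemma coeff_sum_diff [simp]: "coeff_sum \<phi> (f - g) = coeff_sum \<phi> f - coeff_sum \<phi> g"
  using coeff_sum_add[of \<phi> f "smult (-1) g"] coeff_sum_smult[of \<phi> "-1" g] by simp

lemma coeff_sum_sum: "coeff_sum \<phi> (\<Sum>i\<in>A. f i) = (\<Sum>i\<in>A. coeff_sum \<phi> (f i))"
  by (induction A rule: infinite_finite_induct) auto

lemma coeff_sum_pCons: "coeff_sum \<phi> (pCons a f) = a * \<phi> 0 + coeff_sum (\<lambda>k. \<phi> (Suc k)) f"
proof -
  have "coeff_sum \<phi> (pCons a f) = (\<Sum>k\<le>Suc (degree f). coeff (pCons a f) k * \<phi> k)"
    by (rule coeff_sum_eq) (simp add: degree_pCons_le)
  then show ?thesis
    by (simp add: sum.atMost_Suc_shift coeff_sum_def del: sum.atMost_Suc)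
qed

lemma coeff_sum_monom_mult: "coeff_sum \<phi> (monom 1 m * f) = coeff_sum (\<lambda>k. \<phi> (k + m)) f"
  by (induction m arbitrary: \<phi>)
     (simp_all add: monom_0 monom_Suc coeff_sum_pCons flip: one_pCons)

text \<open>Multiplication by X^m only shifts the weight \<open>\<phi>\<close>, so a weight of
  period \<open>m\<close> defines a functional on Z[X]/(X^m - 1).\<close>

lemma coeff_sum_cong_periodic:
  assumes "(\<lambda>k. \<phi> (k + m)) = \<phi>" and "(monom 1 m - 1) dvd f - g"
  shows "coeff_sum \<phi> f = coeff_sum \<phi> g"
proof -
  obtain u where "f - g = (monom 1 m - 1) * u"
    using assms(2) by blast
  then have "f - g = monom 1 m * u - u"
    by (simp add: algebra_simps)
  then have "coeff_sum \<phi> (f - g) = coeff_sum \<phi> (monom 1 m * u - u)"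
    by (rule arg_cong)
  then show ?thesis
    by (simp add: coeff_sum_monom_mult assms(1))
qed

lemma coeff_sum_pcompose_monom:
  "coeff_sum \<phi> (pcompose f (monom 1 m)) = coeff_sum (\<lambda>k. \<phi> (m * k)) f"
  by (induction f arbitrary: \<phi>)
     (simp_all add: pcompose_pCons coeff_sum_monom_mult coeff_sum_pCons add.commute)

text \<open>A factor that is a polynomial in X^m preserves exponents modulo \<open>m\<close>: like
  \<open>g\<close>, the product has only exponents that \<open>m\<close> does not divide, and there
  \<open>\<phi>\<close> vanishes.\<close>

lemma coeff_sum_pcompose_monom_mult_eq_0:
  assumes "\<And>k. m dvd k \<Longrightarrow> coeff g k = 0" and "\<And>k. \<not> m dvd k \<Longrightarrow> \<phi> k = 0"
  shows "coeff_sum \<phi> (pcompose f (monom 1 m) * g) = 0"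
  using assms(2)
proof (induction f arbitrary: \<phi>)
  case (pCons a f)
  have "coeff_sum \<phi> g = 0"
    unfolding coeff_sum_def
  proof (intro sum.neutral ballI)
    fix k
    show "coeff g k * \<phi> k = 0"
      using assms(1)[of k] pCons.prems[of k] by (cases "m dvd k") auto
  qed
  moreover have "coeff_sum (\<lambda>k. \<phi> (k + m)) (pcompose f (monom 1 m) * g) = 0"
    by (rule pCons.IH) (simp add: pCons.prems)
  moreover have "pcompose (pCons a f) (monom 1 m) * g
      = smult a g + monom 1 m * (pcompose f (monom 1 m) * g)"
    by (simp add: pcompose_pCons algebra_simps)
  ultimately show ?case
    by (simp add: coeff_sum_monom_mult)
qed simp

lemma coeff_sum_residue:
  assumes "degree f < m"
  shows "coeff_sum (\<lambda>k. of_bool [int k = r] (mod int m)) f = coeff f (nat (r mod int m))"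
proof -
  define k0 where "k0 = nat (r mod int m)"
  have k0: "k0 < m" "int k0 = r mod int m"
    using assms by (auto simp: k0_def nat_less_iff)
  have iff: "[int k = r] (mod int m) \<longleftrightarrow> k = k0" if "k < m" for k
    using that k0 by (auto simp: cong_def simp flip: of_nat_mod)
  have "coeff_sum (\<lambda>k. of_bool [int k = r] (mod int m)) f
      = (\<Sum>k\<le>m-1. coeff f k * of_bool [int k = r] (mod int m))"
    using assms by (intro coeff_sum_eq) auto
  also have "\<dots> = (\<Sum>k\<le>m-1. if k = k0 then coeff f k else 0)"
    using assms by (intro sum.cong) (auto simp: iff)
  also have "\<dots> = coeff f k0"
    using k0 by auto
  finally show ?thesis
    by (simp add: k0_def)
qed

section \<open>Powers of 1 - X and binomial coefficients modulo a prime\<close>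

lemma coeff_one_minus_X_power: "coeff ([:1, -1:] ^ n) k = (-1) ^ k * int (n choose k)"
proof (cases "k \<le> n")
  case True
  then show ?thesis
    by (simp add: coeff_linear_poly_power mult.commute)
next
  case False
  have "degree ([:1, -1 :: int:] ^ n) \<le> n"
    using degree_power_le[of "[:1, -1 :: int:]" n] by simp
  with False show ?thesis
    by (simp add: coeff_eq_0 binomial_eq_0)
qed

lemma degree_one_minus_X_power [simp]: "degree ([:1, -1 :: int:] ^ n) = n"
  by (simp add: degree_power_eq)

lemma coeff_sum_one_minus_X_power:
  "coeff_sum (\<lambda>k. of_bool (P k)) ([:1, -1:] ^ n) = (\<Sum>k | k \<le> n \<and> P k. (-1) ^ k * int (n choose k))"
proof -
  have "coeff_sum (\<lambda>k. of_bool (P k)) ([:1, -1:] ^ n)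
      = (\<Sum>k\<le>n. if P k then (-1) ^ k * int (n choose k) else 0)"
    unfolding coeff_sum_def coeff_one_minus_X_power degree_one_minus_X_power
    by (intro sum.cong) auto
  also have "\<dots> = (\<Sum>k | k \<in> {..n} \<and> P k. (-1) ^ k * int (n choose k))"
    by (rule sum.inter_filter[symmetric]) simp
  finally show ?thesis
    by simp
qed

text \<open>The inner binomial coefficients are multiples of \<open>p\<close>. Needed in a
  polynomial ring, for the p-th powers of 1 - X and of \<open>W\<close>.\<close>

lemma power_add_prime:
  fixes a b :: "'a :: comm_ring_1"
  assumes "prime p"
  obtains c where "(a + b) ^ p = a ^ p + b ^ p + of_nat p * c"
proof -
  have "p > 0"
    using assms prime_gt_0_nat by blast
  define h where "h k = of_nat ((p choose k) div p) * a ^ k * b ^ (p - k)" for k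
  have "(a + b) ^ p = (\<Sum>k\<le>p. of_nat (p choose k) * a ^ k * b ^ (p - k))"
    by (rule binomial_ring)
  also have "{..p} = insert 0 (insert p {1..<p})"
    using \<open>p > 0\<close> by auto
  also have "(\<Sum>k\<in>insert 0 (insert p {1..<p}). of_nat (p choose k) * a ^ k * b ^ (p - k))
      = a ^ p + b ^ p + (\<Sum>k\<in>{1..<p}. of_nat (p choose k) * a ^ k * b ^ (p - k))"
    using \<open>p > 0\<close> by (subst sum.insert) (auto simp: algebra_simps)
  also have "(\<Sum>k\<in>{1..<p}. of_nat (p choose k) * a ^ k * b ^ (p - k)) = (\<Sum>k\<in>{1..<p}. of_nat p * h k)"
  proof (intro sum.cong refl)
    fix k assume "k \<in> {1..<p}"
    then have "p dvd (p choose k)"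
      using assms by (intro dvd_choose_prime) auto
    then have "(of_nat (p choose k) :: 'a) = of_nat p * of_nat ((p choose k) div p)"
      by (metis dvd_mult_div_cancel of_nat_mult)
    then show "of_nat (p choose k) * a ^ k * b ^ (p - k) = of_nat p * h k"
      by (simp add: h_def mult_ac)
  qed
  finally show thesis
    using that[of "sum h {1..<p}"] by (simp add: sum_distrib_left)
qed

text \<open>By Pascal's rule, and since \<open>p\<close> divides the inner entries of row
  \<open>p\<close>, consecutive signed entries of row \<open>p - 1\<close> agree modulo
  \<open>p\<close>.\<close>

lemma prime_choose_minus_one_cong:
  assumes "prime p" "k < p"
  shows "[(-1) ^ k * int ((p - 1) choose k) = 1] (mod int p)"
  using assms(2)
proof (induction k)
  case (Suc k)
  have "p choose Suc k = ((p - 1) choose k) + ((p - 1) choose Suc k)"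
    using Suc.prems by (cases p) auto
  then have *: "int ((p - 1) choose Suc k) = int (p choose Suc k) - int ((p - 1) choose k)"
    by simp
  have "p dvd (p choose Suc k)"
    using assms Suc.prems by (intro dvd_choose_prime) auto
  then have "[(-1) ^ Suc k * int (p choose Suc k) = 0] (mod int p)"
    by (simp add: cong_0_iff del: binomial_Suc_Suc)
  with Suc have "[(-1) ^ Suc k * int (p choose Suc k) + (-1) ^ k * int ((p - 1) choose k) = 0 + 1] (mod int p)"
    by (intro cong_add) auto
  then show ?case
    unfolding * by (simp add: algebra_simps)
qed (simp add: cong_def)

text \<open>The signed entries of row \<open>p - 2\<close> are the partial sums of those of row
  \<open>p - 1\<close>, which are all 1 modulo \<open>p\<close>. The range includes k = p - 1, where
  both sides vanish modulo \<open>p\<close>, so that every residue class is covered.\<close>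

lemma prime_choose_minus_two_cong:
  assumes "prime p" "k < p"
  shows "[(-1) ^ k * int ((p - 2) choose k) = int k + 1] (mod int p)"
  using assms(2)
proof (induction k)
  case (Suc k)
  have "(p - 1) choose Suc k = ((p - 2) choose k) + ((p - 2) choose Suc k)"
  proof -
    have "p - 1 = Suc (p - 2)"
      using Suc.prems by simp
    then show ?thesis
      by simp
  qed
  then have *: "int ((p - 2) choose Suc k) = int ((p - 1) choose Suc k) - int ((p - 2) choose k)"
    by simp
  have "[(-1) ^ Suc k * int ((p - 1) choose Suc k) + (-1) ^ k * int ((p - 2) choose k) = 1 + (int k + 1)] (mod int p)"
    using assms Suc by (intro cong_add prime_choose_minus_one_cong) auto
  then show ?case
    unfolding * by (simp add: algebra_simps)
qed simp

section \<open>Powers of 1 - X modulo X^p - 1\<close>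

lemma one_minus_X_times_geometric:
  "[:1, -1:] * (\<Sum>i<p. monom 1 i) = 1 - (monom 1 p :: int poly)"
  by (induction p) (simp_all add: distrib_left monom_Suc monom_0 flip: one_pCons)

text \<open>The last two clauses encode \<open>W(1) = -1\<close> and \<open>W'(1) = -(p - 1)/2\<close>.\<close>

lemma one_minus_X_power_prime_minus_one:
  assumes "prime p" "odd p"
  obtains W V :: "int poly" where
    "[:1, -1:] ^ (p - 1) = (\<Sum>i<p. monom 1 i) + smult (int p) W"
    "W = [:1, -1:] * V - 1"
    "2 * poly V 1 = int p - 1"
proof -
  have "p \<ge> 3"
    using assms prime_ge_2_nat[of p] by (cases "p = 2") auto
  define N :: "int poly" where "N = (\<Sum>i<p. monom 1 i)"
  have coeff_N: "coeff N k = (if k < p then 1 else 0)" for k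
    by (auto simp: N_def coeff_sum)
  have "int p dvd coeff ([:1, -1:] ^ (p - 1) - N) k" for k
    using prime_choose_minus_one_cong[OF assms(1), of k] \<open>p \<ge> 3\<close>
    by (auto simp: coeff_N coeff_one_minus_X_power cong_iff_dvd_diff binomial_eq_0)
  then have "[:int p:] dvd [:1, -1:] ^ (p - 1) - N"
    by (simp only: const_poly_dvd_iff) blast
  then obtain W where "[:1, -1:] ^ (p - 1) - N = [:int p:] * W"
    by blast
  then have W: "[:1, -1:] ^ (p - 1) = N + smult (int p) W"
    by (simp add: algebra_simps)
  \<comment> \<open>Evaluation at 1, where \<open>N\<close> takes the value \<open>p\<close>, gives
    W(1) = -1.\<close>
  have "poly ([:1, -1:] ^ (p - 1)) (1::int) = 0"
    using \<open>p \<ge> 3\<close> by (simp add: poly_power)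
  then have "int p * (1 + poly W 1) = 0"
    unfolding W by (simp add: N_def poly_sum poly_monom algebra_simps)
  then have "poly (W + 1) 1 = 0"
    using \<open>p \<ge> 3\<close> by simp
  then obtain V where V: "W + 1 = [:-1, 1:] * V"
    unfolding poly_eq_0_iff_dvd by (rule dvdE)
  then have W': "W = [:1, -1:] * (- V) - 1"
    by (simp add: algebra_simps eq_diff_eq)
  \<comment> \<open>As \<open>p - 1 \<ge> 2\<close>, the root 1 is multiple and the derivative
    vanishes there too; N'(1) = p(p - 1)/2 then determines W'(1), which is V(1) for this
    \<open>V\<close>. The witness handed out is \<open>- V\<close>, because the division was by X -
    1 and not by 1 - X.\<close>
  have "poly (pderiv ([:1, -1:] ^ (p - 1))) (1::int) = 0"
    using \<open>p \<ge> 3\<close> by (simp add: pderiv_power poly_power)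
  moreover have "poly (pderiv N) 1 = (\<Sum>i<p. int i)"
    by (simp add: N_def higher_pderiv_sum[of 1, simplified] pderiv_monom poly_sum poly_monom)
  moreover have "2 * (\<Sum>i<p. int i) = int p * (int p - 1)"
    by (induction p) (auto simp: algebra_simps)
  moreover have "poly (pderiv W) 1 = poly V 1"
    unfolding W' by (simp add: pderiv_mult pderiv_diff pderiv_minus pderiv_pCons)
  ultimately have "int p * (int p - 1 + 2 * poly V 1) = 0"
    unfolding W by (simp add: pderiv_add pderiv_smult algebra_simps)
  then have "2 * poly (- V) 1 = int p - 1"
    using \<open>p \<ge> 3\<close> by simp
  with W W' show thesis
    using that unfolding N_def by blast
qed

text \<open>Each factor Y^(p-1) may be replaced by \<open>p\<close> times \<open>W\<close>: the
  remaining N is annihilated by Y modulo X^p - 1, and \<open>m > 0\<close> guarantees that a factor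
  Y is present.\<close>

lemma one_minus_X_power_reduce:
  fixes W :: "int poly"
  assumes W: "[:1, -1:] ^ (p - 1) = (\<Sum>i<p. monom 1 i) + smult (int p) W" and "m > 0"
  shows "(monom 1 p - 1) dvd [:1, -1:] ^ (q * (p - 1) + m) - smult (int p ^ q) (W ^ q * [:1, -1:] ^ m)"
proof (induction q)
  case (Suc q)
  let ?Y = "[:1, -1:] :: int poly" and ?N = "(\<Sum>i<p. monom 1 i) :: int poly"
  have "?Y ^ m * ?N = (monom 1 p - 1) * (- (?Y ^ (m - 1)))"
  proof -
    have "?Y ^ m = ?Y ^ (m - 1) * ?Y"
      using \<open>m > 0\<close> by (cases m) (simp_all add: mult.commute)
    then have "?Y ^ m * ?N = ?Y ^ (m - 1) * (?Y * ?N)"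
      by (simp only: mult.assoc)
    then show ?thesis
      unfolding one_minus_X_times_geometric by (simp add: algebra_simps)
  qed
  then have N: "(monom 1 p - 1) dvd ?Y ^ m * ?N"
    by simp
  have eq: "?Y ^ (Suc q * (p - 1) + m) - smult (int p ^ Suc q) (W ^ Suc q * ?Y ^ m)
     = ?Y ^ (p - 1) * (?Y ^ (q * (p - 1) + m) - smult (int p ^ q) (W ^ q * ?Y ^ m))
       + smult (int p ^ q) (W ^ q) * (?Y ^ m * ?N)" (is "_ = ?R")
  proof -
    have N': "?N = ?Y ^ (p - 1) - smult (int p) W"
      unfolding W by simp
    have split: "?Y ^ (Suc q * (p - 1) + m) = ?Y ^ (p - 1) * ?Y ^ (q * (p - 1) + m)"
      by (simp only: mult_Suc power_add mult.assoc)
    show ?thesis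
      unfolding N' split by (simp add: algebra_simps smult_diff_right smult_add_right)
  qed
  show ?case
    unfolding eq by (intro dvd_add dvd_mult Suc.IH N)
qed simp

lemma pcompose_power: "pcompose (f ^ n) g = pcompose f g ^ n"
  for f g :: "'a::comm_semiring_1 poly"
  by (induction n) (simp_all add: pcompose_1 pcompose_mult)

lemma pcompose_monom: "pcompose (monom c n) g = smult c (g ^ n)"
  for g :: "'a::comm_semiring_1 poly"
  by (simp add: monom_altdef pcompose_smult pcompose_power pcompose_pCons)

lemma one_minus_X_power_prime:
  assumes "prime p" "odd p"
  obtains g :: "int poly" where
    "[:1, -1:] ^ p = pcompose [:1, -1:] (monom 1 p) + smult (int p) g"
    "\<And>k. p dvd k \<Longrightarrow> coeff g k = 0"
proof -
  have "p > 0"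
    using assms(1) prime_gt_0_nat by blast
  obtain g :: "int poly" where "(1 + [:0, -1:]) ^ p = 1 ^ p + [:0, -1:] ^ p + of_nat p * g"
    using power_add_prime[OF assms(1)] by blast
  moreover have "[:0, -1:] ^ p = - (monom 1 p :: int poly)"
  proof -
    have "[:0, -1:] = - ([:0, 1:] :: int poly)"
      by simp
    then show ?thesis
      by (simp only: power_minus_odd[OF assms(2)] monom_altdef smult_1_left)
  qed
  moreover have "pcompose [:1, -1:] (monom 1 p) = 1 - (monom 1 p :: int poly)"
    by (simp add: pcompose_pCons flip: one_pCons)
  moreover have "of_nat p * g = smult (int p) g"
    by (simp add: of_nat_poly)
  moreover have "1 + [:0, -1:] = [:1, -1 :: int:]"
    by (simp add: one_pCons)
  ultimately have g: "[:1, -1:] ^ p = 1 - monom 1 p + smult (int p) g"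
    and F: "pcompose [:1, -1:] (monom 1 p) = 1 - (monom 1 p :: int poly)"
    by (simp_all only: power_one diff_conv_add_uminus)
  \<comment> \<open>Up to the degree \<open>p\<close> the only multiples of \<open>p\<close> are 0
    and \<open>p\<close>, where 1 - X^p already has the coefficients of (1 - X)^p.\<close>
  have "coeff g k = 0" if "p dvd k" for k
  proof -
    have "coeff ([:1, -1:] ^ p) k = (if k = 0 then 1 else 0) - (if k = p then 1 else 0) + int p * coeff g k"
      unfolding g by auto
    moreover have "k = 0 \<or> k = p \<or> k > p"
      using that by (metis dvd_imp_le linorder_neqE_nat not_less zero_less_iff_neq_zero)
    ultimately show ?thesis
      using \<open>p > 0\<close> assms(2) by (auto simp: coeff_one_minus_X_power binomial_eq_0)
  qed
  with g F show thesis
    using that by simp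
qed

section \<open>The ring (Z/p)[X]/(X^p - 1), with \<open>fold_cong\<close> as its equality\<close>

definition fold_cong :: "nat \<Rightarrow> int poly \<Rightarrow> int poly \<Rightarrow> bool" where
  "fold_cong p f g \<longleftrightarrow> (\<exists>u v. f - g = (monom 1 p - 1) * u + smult (int p) v)"

lemma fold_cong_mult_left:
  assumes "fold_cong p f g"
  shows "fold_cong p (h * f) (h * g)"
proof -
  obtain u v where "f - g = (monom 1 p - 1) * u + smult (int p) v"
    using assms unfolding fold_cong_def by blast
  then have "h * f - h * g = h * ((monom 1 p - 1) * u + smult (int p) v)"
    by (metis right_diff_distrib)
  then have "h * f - h * g = (monom 1 p - 1) * (h * u) + smult (int p) (h * v)"
    by (simp add: algebra_simps)
  then show ?thesis
    unfolding fold_cong_def by blast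
qed

lemma coeff_sum_fold_cong:
  assumes "(\<lambda>k. \<phi> (k + p)) = \<phi>" and "fold_cong p f g"
  shows "[coeff_sum \<phi> f = coeff_sum \<phi> g] (mod int p)"
proof -
  obtain u v where uv: "f - g = (monom 1 p - 1) * u + smult (int p) v"
    using assms unfolding fold_cong_def by blast
  then have "f - (g + smult (int p) v) = (monom 1 p - 1) * u"
    by (simp add: algebra_simps)
  then have "coeff_sum \<phi> f = coeff_sum \<phi> (g + smult (int p) v)"
    by (intro coeff_sum_cong_periodic[OF assms(1)]) auto
  then show ?thesis
    by (simp add: cong_iff_dvd_diff)
qed

lemma fold_cong_one_minus_X_power_prime:
  assumes "prime p" "odd p"
  shows "fold_cong p (f + [:1, -1:] ^ p * h) f"
proof -
  obtain g :: "int poly" where g: "[:1, -1:] ^ p = pcompose [:1, -1:] (monom 1 p) + smult (int p) g"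
    using one_minus_X_power_prime[OF assms] by blast
  have F: "pcompose [:1, -1:] (monom 1 p) = 1 - (monom 1 p :: int poly)"
    by (simp add: pcompose_pCons flip: one_pCons)
  have "f + [:1, -1:] ^ p * h - f = (monom 1 p - 1) * (- h) + smult (int p) (g * h)"
    unfolding g F by (simp add: algebra_simps)
  then show ?thesis
    unfolding fold_cong_def by blast
qed

lemma residue_indicator_periodic:
  "(\<lambda>k. of_bool [int (k + m) = r] (mod int m)) = (\<lambda>k. of_bool [int k = r] (mod int m))"
  by (simp add: cong_def)

text \<open>First order suffices for the powers of \<open>W\<close>: the remainder, once multiplied
  by Y^(p-2) or Y^(p-1), contains Y^p.\<close>

lemma diff_one_power_expand:
  fixes y v :: "'a :: comm_ring_1"
  obtains z where "(y * v - 1) ^ q = (-1) ^ q * (1 - of_nat q * (y * v)) + y\<^sup>2 * z"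
proof -
  have "\<exists>z. (y * v - 1) ^ q = (-1) ^ q * (1 - of_nat q * (y * v)) + y\<^sup>2 * z"
  proof (induction q)
    case 0
    show ?case
      by (rule exI[of _ 0]) simp
  next
    case (Suc q)
    then obtain z where z: "(y * v - 1) ^ q = (-1) ^ q * (1 - of_nat q * (y * v)) + y\<^sup>2 * z"
      by blast
    have "(y * v - 1) ^ Suc q = (-1) ^ Suc q * (1 - of_nat (Suc q) * (y * v))
        + y\<^sup>2 * ((y * v - 1) * z - (-1) ^ q * of_nat q * v\<^sup>2)"
      unfolding power_Suc z by (simp add: power2_eq_square algebra_simps)
    then show ?case
      by blast
  qed
  then show thesis
    using that by blast
qed

text \<open>Both degrees are below \<open>p\<close>, so each sum is a single signed binomial
  coefficient from row \<open>p - 1\<close> or \<open>p - 2\<close>. All values in (b) are built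
  from these two.\<close>

lemma coeff_sum_one_minus_X_power_top:
  assumes "prime p"
  shows "[coeff_sum (\<lambda>k. of_bool [int k = r] (mod int p)) ([:1, -1:] ^ (p - 1)) = 1] (mod int p)"
    and "[coeff_sum (\<lambda>k. of_bool [int k = r] (mod int p)) ([:1, -1:] ^ (p - 2)) = r + 1] (mod int p)"
proof -
  have p: "p > 0" "p - 1 < p" "p - 2 < p"
    using prime_gt_0_nat[OF assms] by auto
  define k where "k = nat (r mod int p)"
  have k: "k < p" "int k = r mod int p"
    using p by (auto simp: k_def nat_less_iff)
  show "[coeff_sum (\<lambda>k. of_bool [int k = r] (mod int p)) ([:1, -1:] ^ (p - 1)) = 1] (mod int p)"
    using prime_choose_minus_one_cong[OF assms k(1)] p
    by (subst coeff_sum_residue) (auto simp: coeff_one_minus_X_power simp flip: k_def)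
  have "[int k + 1 = r + 1] (mod int p)"
    unfolding k(2) by (intro cong_add) auto
  then show "[coeff_sum (\<lambda>k. of_bool [int k = r] (mod int p)) ([:1, -1:] ^ (p - 2)) = r + 1] (mod int p)"
    using prime_choose_minus_two_cong[OF assms k(1)] p
    by (subst coeff_sum_residue) (auto simp: coeff_one_minus_X_power simp flip: k_def intro: cong_trans)
qed

section \<open>\<open>S1\<close> and \<open>S2\<close> as coefficient sums\<close>

lemma powi_minus_mult_power:
  assumes "p > 0"
  shows "of_nat p powi (- int q) * of_int (int p ^ q * x) = (of_int x :: rat)"
  using assms by (simp add: power_int_minus)

text \<open>The remainder \<open>m\<close> runs from 1 to p - 1 instead of 0 to p - 2 because the
  exponent is the integer part of (n - 1)/(p - 1), not of n/(p - 1).\<close>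

lemma div_decomp:
  assumes "0 < m" "m < p" "n = q * (p - 1) + m"
  shows "(int n - 1) div (int p - 1) = int q"
proof -
  have "int n = int q * int (p - 1) + int m"
    using assms(3) by simp
  then have "int n - 1 = int q * (int p - 1) + (int m - 1)"
    using assms by (simp add: of_nat_diff)
  then show ?thesis
    using assms by (intro int_div_pos_eq[of _ _ _ "int m - 1"]) (auto simp: mult.commute)
qed

text \<open>Reduction modulo X^p - 1 extracts the factor p^q by which \<open>S1\<close> divides; in
  particular \<open>S1\<close> is an integer.\<close>

lemma S1_eq_coeff_sum:
  assumes "[:1, -1:] ^ (p - 1) = (\<Sum>i<p. monom 1 i) + smult (int p) W"
    and "0 < m" "m < p" "n = q * (p - 1) + m"
  shows "S1 p n r = of_int (coeff_sum (\<lambda>k. of_bool [int k = r] (mod int p)) (W ^ q * [:1, -1:] ^ m))"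
proof -
  let ?\<phi> = "\<lambda>k. of_bool [int k = r] (mod int p) :: int"
  have "coeff_sum ?\<phi> ([:1, -1:] ^ n) = coeff_sum ?\<phi> (smult (int p ^ q) (W ^ q * [:1, -1:] ^ m))"
    unfolding assms(4)
    by (rule coeff_sum_cong_periodic[OF residue_indicator_periodic one_minus_X_power_reduce]) fact+
  then have *: "(\<Sum>k | k \<le> n \<and> [int k = r] (mod int p). (-1) ^ k * int (n choose k))
      = int p ^ q * coeff_sum ?\<phi> (W ^ q * [:1, -1:] ^ m)"
    by (simp add: coeff_sum_one_minus_X_power)
  then have "(\<Sum>k | k \<le> n \<and> [int k = r] (mod int p). (-1) ^ k * of_nat (n choose k))
      = (of_int (int p ^ q * coeff_sum ?\<phi> (W ^ q * [:1, -1:] ^ m)) :: rat)"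
    by (simp flip: *)
  then show ?thesis
    unfolding S1_def div_decomp[OF assms(2-4)] using assms(3)
    by (simp only: powi_minus_mult_power)
qed

text \<open>In the binomial expansion of \<open>((1 - X\<^sup>p) + p g)\<^sup>n\<close> the term \<open>j = 1\<close> contributes nothing,
  and for \<open>j \<ge> 2\<close> the factor \<open>p\<^sup>j\<close> gains more powers of \<open>p\<close> than \<open>(1 - X\<^sup>p)\<^sup>n\<^sup>-\<^sup>j\<close> loses
  against \<open>(1 - X\<^sup>p)\<^sup>n\<close>.\<close>

lemma coeff_sum_one_minus_X_power_square:
  assumes "prime p" "odd p" and n: "0 < m" "n = q * (p - 1) + m"
  shows "[coeff_sum (\<lambda>k. of_bool [int k = int p * r] (mod (int p)\<^sup>2)) ([:1, -1:] ^ (p * n))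
        = coeff_sum (\<lambda>k. of_bool [int k = r] (mod int p)) ([:1, -1:] ^ n)] (mod int p ^ Suc q)"
proof -
  let ?Y = "[:1, -1:] :: int poly"
  let ?\<phi> = "\<lambda>k. of_bool [int k = int p * r] (mod (int p)\<^sup>2) :: int"
  let ?\<psi> = "\<lambda>k. of_bool [int k = r] (mod int p) :: int"
  have "p \<ge> 3"
    using assms prime_ge_2_nat[of p] by (cases "p = 2") auto
  have "n > 0"
    using n by simp
  obtain g :: "int poly" where g: "?Y ^ p = pcompose ?Y (monom 1 p) + smult (int p) g"
    and g0: "\<And>k. p dvd k \<Longrightarrow> coeff g k = 0"
    using one_minus_X_power_prime[OF assms(1,2)] by blast
  obtain W :: "int poly" where W: "?Y ^ (p - 1) = (\<Sum>i<p. monom 1 i) + smult (int p) W"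
    using one_minus_X_power_prime_minus_one[OF assms(1,2)] by blast
  define t where "t j = of_nat (n choose j) * smult (int p) g ^ j * pcompose ?Y (monom 1 p) ^ (n - j)" for j
  have "?Y ^ (p * n) = (smult (int p) g + pcompose ?Y (monom 1 p)) ^ n"
    by (simp add: power_mult g add.commute)
  also have "\<dots> = (\<Sum>j\<le>n. t j)"
    unfolding t_def by (rule binomial_ring)
  also have "\<dots> = t 0 + (\<Sum>j\<in>{1..n}. t j)"
  proof -
    have "{..n} = insert 0 {1..n}"
      by auto
    then show ?thesis
      by simp
  qed
  finally have expand: "?Y ^ (p * n) = t 0 + (\<Sum>j\<in>{1..n}. t j)" .
  \<comment> \<open>Substituting X^p for X multiplies exponents by \<open>p\<close>, and pk = pr
    modulo p^2 means k = r modulo p.\<close>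
  have t0: "coeff_sum ?\<phi> (t 0) = coeff_sum ?\<psi> (?Y ^ n)"
  proof -
    have "[int (p * k) = int p * r] (mod (int p)\<^sup>2) \<longleftrightarrow> [int k = r] (mod int p)" for k
      using \<open>p \<ge> 3\<close> by (simp add: cong_def power2_eq_square mod_mult_mult1)
    then show ?thesis
      by (simp add: t_def coeff_sum_pcompose_monom flip: pcompose_power)
  qed
  have \<phi>_0: "?\<phi> k = 0" if "\<not> p dvd k" for k
  proof -
    have "\<not> [int k = int p * r] (mod (int p)\<^sup>2)"
    proof
      assume "[int k = int p * r] (mod (int p)\<^sup>2)"
      then have "[int k = int p * r] (mod int p)"
        by (rule cong_dvd_modulus) (simp add: power2_eq_square)
      then have "int p dvd int k"
        by (simp add: cong_def mod_eq_0_iff_dvd[symmetric])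
      then show False
        using that by simp
    qed
    then show ?thesis
      by simp
  qed
  have tj: "int p ^ Suc q dvd coeff_sum ?\<phi> (t j)" if j: "j \<in> {1..n}" for j
  proof (cases "j = 1")
    case True
    have "coeff_sum ?\<phi> (pcompose (?Y ^ (n - 1)) (monom 1 p) * g) = 0"
      by (rule coeff_sum_pcompose_monom_mult_eq_0[of p]) (use g0 \<phi>_0 in auto)
    moreover have "t j = smult (int n * int p) (pcompose (?Y ^ (n - 1)) (monom 1 p) * g)"
      using True by (simp add: t_def pcompose_power of_nat_poly mult_ac)
    ultimately show ?thesis
      by simp
  next
    case False
    with j have j2: "j \<ge> 2"
      by auto
    \<comment> \<open>Once \<open>p ^ j\<close> is taken out, \<open>e\<close> further factors
      \<open>p\<close> are missing; truncated subtraction gives 0 when \<open>p ^ j\<close> already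
      suffices.\<close>
    define e where "e = Suc q - j"
    have "\<exists>h. (monom 1 p - 1) dvd ?Y ^ (n - j) - smult (int p ^ e) h"
    proof (cases "e = 0")
      case True
      then show ?thesis
        by (intro exI[of _ "?Y ^ (n - j)"]) simp
    next
      case False
      \<comment> \<open>A positive power of Y must remain for the reduction: n - e(p - 1) = (j -
        1)(p - 1) + m is at least 2(j - 1) + 1, which exceeds \<open>j\<close> since
        \<open>j \<ge> 2\<close>.\<close>
      have "e * (p - 1) + j < n"
      proof -
        have "(j - 1) * 2 \<le> (j - 1) * (p - 1)"
          using \<open>p \<ge> 3\<close> by (intro mult_le_mono) auto
        moreover have "q = e + (j - 1)"
          using False j2 by (simp add: e_def)
        moreover have "n = e * (p - 1) + (j - 1) * (p - 1) + m"
          unfolding n(2) \<open>q = e + (j - 1)\<close> by (rule arg_cong[OF distrib_right])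
        ultimately show ?thesis
          using j2 n(1) by linarith
      qed
      then obtain l where "n - j = e * (p - 1) + l" "l > 0"
        using that[of "n - j - e * (p - 1)"] by auto
      then show ?thesis
        using one_minus_X_power_reduce[OF W, of l e] by auto
    qed
    then obtain h u where hu: "?Y ^ (n - j) - smult (int p ^ e) h = (monom 1 p - 1) * u"
      by blast
    define c where "c = smult (int (n choose j)) (g ^ j)"
    \<comment> \<open>The substitution turns X^p - 1 into X^(p^2) - 1, and \<open>?\<phi>\<close>
      has period p^2.\<close>
    have "pcompose (?Y ^ (n - j) - smult (int p ^ e) h) (monom 1 p) = (monom 1 (p ^ 2) - 1) * pcompose u (monom 1 p)"
    proof -
      have "pcompose (monom 1 p) (monom 1 p :: int poly) = monom 1 (p ^ 2)"
        by (simp add: pcompose_monom monom_power power2_eq_square)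
      then show ?thesis
        unfolding hu by (simp add: pcompose_mult pcompose_diff pcompose_1)
    qed
    then have "(pcompose (?Y ^ (n - j)) (monom 1 p) - smult (int p ^ e) (pcompose h (monom 1 p))) * c
        = (monom 1 (p ^ 2) - 1) * pcompose u (monom 1 p) * c"
      by (simp only: pcompose_diff pcompose_smult)
    then have "pcompose (?Y ^ (n - j)) (monom 1 p) * c - smult (int p ^ e) (pcompose h (monom 1 p) * c)
        = (monom 1 (p ^ 2) - 1) * (pcompose u (monom 1 p) * c)"
      by (simp only: left_diff_distrib mult_smult_left mult.assoc)
    then have "coeff_sum ?\<phi> (pcompose (?Y ^ (n - j)) (monom 1 p) * c)
        = coeff_sum ?\<phi> (smult (int p ^ e) (pcompose h (monom 1 p) * c))"
      by (intro coeff_sum_cong_periodic[of _ "p ^ 2"]) (auto simp: cong_def)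
    moreover have "t j = smult (int p ^ j) (pcompose (?Y ^ (n - j)) (monom 1 p) * c)"
      by (simp add: t_def c_def pcompose_power of_nat_poly smult_power mult_ac)
    ultimately have "coeff_sum ?\<phi> (t j) = int p ^ (j + e) * coeff_sum ?\<phi> (pcompose h (monom 1 p) * c)"
      by (simp add: power_add)
    moreover have "int p ^ Suc q dvd int p ^ (j + e)"
      by (rule le_imp_power_dvd) (simp add: e_def)
    ultimately show ?thesis
      by simp
  qed
  have "int p ^ Suc q dvd coeff_sum ?\<phi> (\<Sum>j\<in>{1..n}. t j)"
    unfolding coeff_sum_sum by (rule dvd_sum) (rule tj)
  then show ?thesis
    unfolding expand by (simp only: coeff_sum_add t0) (simp add: cong_iff_dvd_diff)
qed

section \<open>Halves modulo an odd prime, and the three congruences\<close>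

lemma rat_cong_half:
  assumes "odd p" "[2 * x = y] (mod int p)"
  shows "rat_cong p (of_int x) (of_int y / 2)"
proof -
  have half: "p_integral p (of_int z / 2)" for z
    unfolding p_integral_def
    using assms(1) by (intro exI[of _ z] exI[of _ 2]) (simp add: coprime_left_2_iff_odd)
  obtain k where "2 * x - y = int p * k"
    using assms(2) by (auto simp: cong_iff_dvd_diff)
  then have "(of_int (2 * x - y) :: rat) = of_int (int p * k)"
    by simp
  then have "of_int x - of_int y / 2 = of_nat p * (of_int k / 2 :: rat)"
    by (simp add: field_simps)
  then show ?thesis
    unfolding rat_cong_def using half p_integral_of_int by blast
qed

theorem theorem1p15:
  fixes p n :: nat and r :: int
  assumes "prime p" and "odd p" and "n > 0"
  shows "rat_cong p (S1 p n r) (S2 p n r)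
    \<and> (\<forall>s::int. int n = (int p - 1) * s \<longrightarrow>
          rat_cong p (S1 p n r) ((-1) powi (s - 1)))
    \<and> (\<forall>s::int. int n = (int p - 1) * s - 1 \<longrightarrow>
          rat_cong p (S1 p n r) ((-1) powi (s - 1) * ((of_int s + 1) / 2 + of_int r)))
    \<and> rat_cong p (S1 p (n + p * (p - 1)) r) (- S1 p n r)"
proof (intro conjI allI impI)
  let ?Y = "[:1, -1:] :: int poly"
  define L where "L = coeff_sum (\<lambda>k. of_bool [int k = r] (mod int p))"
  have p3: "p \<ge> 3"
    using assms prime_ge_2_nat[of p] by (cases "p = 2") auto
  obtain W V :: "int poly" where
    W: "?Y ^ (p - 1) = (\<Sum>i<p. monom 1 i) + smult (int p) W"
    and V: "W = ?Y * V - 1" and V1: "2 * poly V 1 = int p - 1"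
    using one_minus_X_power_prime_minus_one[OF assms(1,2)] by blast
  have L_cong: "[L f = L g] (mod int p)" if "fold_cong p f g" for f g
    unfolding L_def using residue_indicator_periodic that by (rule coeff_sum_fold_cong)
  have L_top: "[L (?Y ^ (p - 1)) = 1] (mod int p)" "[L (?Y ^ (p - 2)) = r + 1] (mod int p)"
    unfolding L_def by (rule coeff_sum_one_minus_X_power_top[OF assms(1)])+
  have S1_L: "S1 p (q * (p - 1) + m) r = of_int (L (W ^ q * ?Y ^ m))" if "0 < m" "m < p" for q m
    unfolding L_def by (rule S1_eq_coeff_sum[OF W that refl])
  have Y_pow: "?Y ^ (p - 1) = ?Y ^ (p - 2) * ?Y" "?Y ^ p = ?Y ^ (p - 2) * ?Y\<^sup>2"
    using p3 by (simp_all only: power_Suc2[symmetric] power_add[symmetric])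
                (simp_all add: numeral_2_eq_2 Suc_diff_Suc)

  have sgn: "(-1) ^ q * f = smult ((-1) ^ q) f" for q and f :: "int poly"
    by (cases "even q") auto

  define q m where "q = (n - 1) div (p - 1)" and "m = Suc ((n - 1) mod (p - 1))"
  have "(n - 1) mod (p - 1) < p - 1"
    using p3 by simp
  then have m: "0 < m" "m < p"
    unfolding m_def by auto
  have n: "n = q * (p - 1) + m"
    using \<open>n > 0\<close> div_mult_mod_eq[of "n - 1" "p - 1"] unfolding q_def m_def by linarith

  show "rat_cong p (S1 p n r) (S2 p n r)"
  proof -
    let ?sum = "\<Sum>k | k \<le> p * n \<and> [int k = int p * r] (mod (int p)\<^sup>2). (-1) ^ k * int ((p * n) choose k)"
    have "L (?Y ^ n) = int p ^ q * L (W ^ q * ?Y ^ m)"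
      unfolding L_def n
      using coeff_sum_cong_periodic[OF residue_indicator_periodic one_minus_X_power_reduce[OF W m(1), of q]]
      by simp
    \<comment> \<open>A congruence modulo p^(q+1) between sums divisible by p^q becomes a congruence
      modulo \<open>p\<close> after division by p^q.\<close>
    with coeff_sum_one_minus_X_power_square[OF assms(1,2) m(1) n, of r]
    have "[?sum = int p ^ q * L (W ^ q * ?Y ^ m)] (mod int p ^ Suc q)"
      by (simp add: coeff_sum_one_minus_X_power flip: L_def)
    then obtain z where "?sum - int p ^ q * L (W ^ q * ?Y ^ m) = int p ^ Suc q * z"
      by (auto simp: cong_iff_dvd_diff)
    then have *: "?sum = int p ^ q * (L (W ^ q * ?Y ^ m) + int p * z)"
      by (simp add: algebra_simps)
    have "(\<Sum>k | k \<le> p * n \<and> [int k = int p * r] (mod (int p)\<^sup>2). (-1) ^ k * of_nat ((p * n) choose k))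
      = (of_int (int p ^ q * (L (W ^ q * ?Y ^ m) + int p * z)) :: rat)"
      by (simp flip: *)
    then have "S2 p n r = of_int (L (W ^ q * ?Y ^ m) + int p * z)"
      unfolding S2_def div_decomp[OF m n] using p3 by (simp only: powi_minus_mult_power)
    moreover have "S1 p n r = of_int (L (W ^ q * ?Y ^ m))"
      unfolding n by (rule S1_L[OF m])
    ultimately show ?thesis
      by (simp only: rat_cong_of_int) (simp add: cong_iff_dvd_diff)
  qed

  show "rat_cong p (S1 p (n + p * (p - 1)) r) (- S1 p n r)"
  proof -
    \<comment> \<open>Raising \<open>n\<close> by p(p - 1) raises \<open>q\<close> by
      \<open>p\<close> and so brings in the factor W^p. Modulo \<open>p\<close> the p-th power is
      additive, giving W^p = Y^p V^p - 1, which is -1 because Y^p vanishes.\<close>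
    obtain c where "(?Y * V + (-1)) ^ p = (?Y * V) ^ p + (-1) ^ p + of_nat p * c"
      using power_add_prime[OF assms(1)] by blast
    moreover have "?Y * V + (-1) = W" "(-1 :: int poly) ^ p = - 1" "of_nat p * c = smult (int p) c"
      using assms(2) by (simp_all add: V of_nat_poly)
    ultimately have Wp: "W ^ p = (- 1 + ?Y ^ p * V ^ p) + smult (int p) c"
      by (simp only: power_mult_distrib add_ac)
    obtain u v where "(- 1 + ?Y ^ p * V ^ p) - (- 1) = (monom 1 p - 1) * u + smult (int p) v"
      using fold_cong_one_minus_X_power_prime[OF assms(1,2), of "- 1" "V ^ p"]
      unfolding fold_cong_def by blast
    then have "W ^ p - (- 1) = (monom 1 p - 1) * u + smult (int p) (v + c)"
      unfolding Wp by (simp add: algebra_simps smult_add_right)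
    then have "fold_cong p (W ^ p) (- 1)"
      unfolding fold_cong_def by blast
    then have "[L (W ^ q * ?Y ^ m * W ^ p) = L (W ^ q * ?Y ^ m * (- 1))] (mod int p)"
      by (intro L_cong fold_cong_mult_left)
    moreover have "W ^ q * ?Y ^ m * W ^ p = W ^ (q + p) * ?Y ^ m"
      by (simp only: power_add mult_ac)
    moreover have "L (W ^ q * ?Y ^ m * (- 1)) = - L (W ^ q * ?Y ^ m)"
      unfolding L_def using coeff_sum_diff[of _ 0] by simp
    moreover have "n + p * (p - 1) = (q + p) * (p - 1) + m"
      by (simp add: n distrib_right)
    ultimately show ?thesis
      using S1_L[OF m, of "q + p"] S1_L[OF m, of q] unfolding n
      by (simp only: rat_cong_of_int flip: of_int_minus)
  qed

  have int_p: "int (p - 1) = int p - 1" "int (p - 2) = int p - 2"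
    using p3 by auto
  fix s :: int
  {
    assume s: "int n = (int p - 1) * s"
    have "s > 0"
      using s \<open>n > 0\<close> p3 zero_less_mult_pos[of "int p - 1" s] by linarith
    \<comment> \<open>Here \<open>m\<close> is p - 1, the largest remainder allowed, so the quotient
      is s - 1 rather than s.\<close>
    define q where "q = nat (s - 1)"
    have q: "s - 1 = int q"
      using \<open>s > 0\<close> by (simp add: q_def)
    have "int n = int q * (int p - 1) + (int p - 1)"
      using s q by (simp add: algebra_simps)
    also have "\<dots> = int (q * (p - 1) + (p - 1))"
      by (simp only: of_nat_add of_nat_mult int_p)
    finally have n: "n = q * (p - 1) + (p - 1)"
      by (simp only: of_nat_eq_iff)
    obtain z where z: "W ^ q = (-1) ^ q * (1 - of_nat q * (?Y * V)) + ?Y\<^sup>2 * z"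
      unfolding V by (rule diff_one_power_expand)
    \<comment> \<open>Multiplied by Y^(p-1), already the linear term of W^q contains Y^p; only the
      constant term (-1)^q survives.\<close>
    have "W ^ q * ?Y ^ (p - 1) = smult ((-1) ^ q) (?Y ^ (p - 1))
        + ?Y ^ p * (?Y * z - (-1) ^ q * of_nat q * V)"
    proof -
      have "(e * (1 - k * (y * V)) + y\<^sup>2 * z) * (a * y) = e * (a * y) + a * y\<^sup>2 * (y * z - e * k * V)"
        for e k y a :: "int poly"
        by (simp add: power2_eq_square algebra_simps)
      then show ?thesis
        unfolding z Y_pow sgn[symmetric] .
    qed
    then have "[L (W ^ q * ?Y ^ (p - 1)) = L (smult ((-1) ^ q) (?Y ^ (p - 1)))] (mod int p)"
      using fold_cong_one_minus_X_power_prime[OF assms(1,2)] by (intro L_cong) metis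
    also have "[L (smult ((-1) ^ q) (?Y ^ (p - 1))) = (-1) ^ q * 1] (mod int p)"
      unfolding L_def coeff_sum_smult using L_top(1) unfolding L_def by (rule cong_scalar_left)
    finally show "rat_cong p (S1 p n r) ((-1) powi (s - 1))"
      using S1_L[of "p - 1" q] p3 unfolding n q by (simp flip: rat_cong_of_int)
  next
    assume s: "int n = (int p - 1) * s - 1"
    have "s > 0"
      using s \<open>n > 0\<close> p3 zero_less_mult_pos[of "int p - 1" s] by linarith
    \<comment> \<open>Now n = (s - 1)(p - 1) + (p - 2), so the linear term of W^q contributes as
      well.\<close>
    define q where "q = nat (s - 1)"
    have q: "s = int q + 1"
      using \<open>s > 0\<close> by (simp add: q_def)
    have "int n = int q * (int p - 1) + (int p - 2)"
      using s q by (simp add: algebra_simps)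
    also have "\<dots> = int (q * (p - 1) + (p - 2))"
      by (simp only: of_nat_add of_nat_mult int_p)
    finally have n: "n = q * (p - 1) + (p - 2)"
      by (simp only: of_nat_eq_iff)
    \<comment> \<open>After multiplication by Y^(p-2), the linear term of W^q depends, modulo Y^p,
      on \<open>V\<close> only through its value at 1.\<close>
    define c where "c = poly V 1"
    have "poly (V - [:c:]) 1 = 0"
      by (simp add: c_def)
    then obtain v where "V - [:c:] = [:-1, 1:] * v"
      unfolding poly_eq_0_iff_dvd by (rule dvdE)
    then have "V - [:c:] = - (?Y * v)"
      by simp
    then have v: "V = [:c:] - ?Y * v"
      by (simp only: diff_eq_eq uminus_add_conv_diff)
    obtain z where z: "W ^ q = (-1) ^ q * (1 - of_nat q * (?Y * V)) + ?Y\<^sup>2 * z"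
      unfolding V by (rule diff_one_power_expand)
    let ?f = "smult ((-1) ^ q) (?Y ^ (p - 2) - smult (int q * c) (?Y ^ (p - 1)))"
    have "W ^ q * ?Y ^ (p - 2) = ?f + ?Y ^ p * (z + (-1) ^ q * of_nat q * v)"
    proof -
      have "(e * (1 - k * (y * (d - y * v))) + y\<^sup>2 * z) * a
          = e * (a - k * d * (a * y)) + a * y\<^sup>2 * (z + e * k * v)" for e k y a d :: "int poly"
        by (simp add: power2_eq_square algebra_simps)
      moreover have "smult (int q * c) f = of_nat q * [:c:] * f" for f
        by (simp add: of_nat_poly mult.commute)
      ultimately show ?thesis
        unfolding z Y_pow sgn[symmetric] by (simp only: v)
    qed
    then have "[L (W ^ q * ?Y ^ (p - 2)) = L ?f] (mod int p)"
      using fold_cong_one_minus_X_power_prime[OF assms(1,2)] by (intro L_cong) metis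
    also have "L ?f = (-1) ^ q * (L (?Y ^ (p - 2)) - int q * c * L (?Y ^ (p - 1)))"
      by (simp add: L_def)
    also have "[\<dots> = (-1) ^ q * ((r + 1) - int q * c * 1)] (mod int p)"
      by (intro cong_mult cong_diff L_top cong_refl)
    \<comment> \<open>Doubling brings in 2c = p - 1, which is -1 modulo \<open>p\<close>; with q = s
      - 1 the value becomes s + 1 + 2r up to the factor (-1)^q, and 2 can be divided out because
      \<open>p\<close> is odd.\<close>
    finally have "[2 * L (W ^ q * ?Y ^ (p - 2)) = 2 * ((-1) ^ q * ((r + 1) - int q * c * 1))] (mod int p)"
      by (rule cong_scalar_left)
    also have "2 * ((-1) ^ q * ((r + 1) - int q * c * 1)) = (-1) ^ q * (2 * r + 2 - int q * (2 * c))"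
      by (simp add: algebra_simps)
    also have "\<dots> = (-1) ^ q * (s + 1 + 2 * r) + int p * (- ((-1) ^ q * int q))"
      unfolding c_def V1 q by (simp add: algebra_simps)
    also have "[\<dots> = (-1) ^ q * (s + 1 + 2 * r)] (mod int p)"
      by (simp add: cong_iff_dvd_diff)
    finally have "rat_cong p (of_int (L (W ^ q * ?Y ^ (p - 2)))) (of_int ((-1) ^ q * (s + 1 + 2 * r)) / 2)"
      by (rule rat_cong_half[OF assms(2)])
    moreover have "of_int ((-1) ^ q * (s + 1 + 2 * r)) / 2
        = ((-1) powi (s - 1) * ((of_int s + 1) / 2 + of_int r) :: rat)"
      by (simp add: q field_simps)
    moreover have "S1 p n r = of_int (L (W ^ q * ?Y ^ (p - 2)))"
      unfolding n using p3 by (intro S1_L) auto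
    ultimately show "rat_cong p (S1 p n r) ((-1) powi (s - 1) * ((of_int s + 1) / 2 + of_int r))"
      by simp
  }
qed

end
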